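(* Let $c \ge 2$ be an integer. Then there is no lattice triangle $T \subseteq \mathbb{R}^2$ such that the pair $(b,i) = (b(T), i(T))$ satisfies \[ \tfrac{c-1}{2}\, b - (c-1) \;<\; i \;<\; \tfrac{c}{2}\, b - c(c+2). \] Equivalently, $\mathcal{T} \cap \sigma_c^\circ = \emptyset$ for every integer $c \ge 2$, where $\mathcal{T} = \{(b(T), i(T)) : T \text{ a lattice triangle}\}$ and $\sigma_c^\circ = \{(b,i) \in \mathbb{R}_{\ge 0}^2 : \tfrac{c-1}{2} b - (c-1) < i < \tfrac{c}{2} b - c(c+2)\}$.
   Context: A lattice polygon is the two-dimensional convex hull of finitely many points of $\mathbb{Z}^2$; a lattice triangle is a lattice polygon with three vertices. For a lattice polygon $P$, $b(P)$ denotes the number of lattice points (points of $\mathbb{Z}^2$) on the boundary of $P$, and $i(P)$ denotes the number of lattice points in the interior of $P$. *)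

theory Defs
  imports "HOL-Analysis.Analysis"
begin

definition lattice_points :: "(real^2) set" where
  "lattice_points = {x. \<forall>k. x $ k \<in> \<int>}"

definition lattice_polygon :: "(real^2) set \<Rightarrow> bool" where
  "lattice_polygon P \<longleftrightarrow>
     (\<exists>V. finite V \<and> V \<subseteq> lattice_points \<and> P = convex hull V) \<and> aff_dim P = 2"

definition lattice_triangle :: "(real^2) set \<Rightarrow> bool" where
  "lattice_triangle T \<longleftrightarrow> lattice_polygon T \<and> card {v. v extreme_point_of T} = 3"

text \<open>Polygons are bounded, so the sets counted in the next two definitions are finite
  and \<open>card\<close> is the actual number of their points.\<close>

definition boundary_count :: "(real^2) set \<Rightarrow> nat" where
  "boundary_count P = card (frontier P \<inter> lattice_points)"

definition interior_count :: "(real^2) set \<Rightarrow> nat" where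
  "interior_count P = card (interior P \<inter> lattice_points)"

definition triangle_pairs :: "(real \<times> real) set" where
  "triangle_pairs = {(real (boundary_count T), real (interior_count T)) | T. lattice_triangle T}"

definition open_sector :: "int \<Rightarrow> (real \<times> real) set" where
  "open_sector c = {(b, i). 0 \<le> b \<and> 0 \<le> i \<and>
     (of_int c - 1) / 2 * b - (of_int c - 1) < i \<and>
     i < of_int c / 2 * b - of_int c * (of_int c + 2)}"

end

theory Submission
  imports Defs
begin

text \<open>
  Let the edges have lattice lengths \<open>x \<ge> y, z\<close>, so that \<open>b = x + y + z\<close>, and let \<open>A\<close> be twice the
  area. By Pick's formula \<open>A = 2 i + b - 2\<close>, the two inequalities say
  \<open>c (b - 2) < A < (c + 1) (b - 2 (c + 1))\<close>. Since \<open>A\<close> is divisible by \<open>x y\<close> and \<open>x z\<close>, the lattice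
  height \<open>h = A / x\<close> over the longest edge is at least \<open>y\<close> and \<open>z\<close>. The lower bound on \<open>A\<close> forces
  \<open>h > c\<close>, and then the upper bound forces \<open>x < 2 (c + 1)\<close>; but the two bounds together
  need \<open>b\<close> to be quadratic in \<open>c\<close>, which contradicts \<open>b \<le> 3 x\<close>.

  Pick's formula for a triangle with edge vectors \<open>u\<close> and \<open>v\<close> comes from the half-open
  parallelogram they span, which contains \<open>det (u, v)\<close> lattice points: a point reflection
  exchanges its two halves.
\<close>

section \<open>Determinants, lattice lengths and unimodular bases\<close>

text \<open>By Cramer's rule, \<open>det2 p v\<close> and \<open>det2 u p\<close> are the
  coordinates of \<open>p\<close> in the basis \<open>u\<close>, \<open>v\<close>, scaled by
  \<open>det2 u v\<close>. Triangles and parallelograms are described below by these two integers,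
  which avoids division.\<close>

definition det2 :: "int \<times> int \<Rightarrow> int \<times> int \<Rightarrow> int" where
  "det2 p q = fst p * snd q - snd p * fst q"

definition lattice_length :: "int \<times> int \<Rightarrow> int" where
  "lattice_length u = gcd (fst u) (snd u)"

lemma det2_add_left: "det2 (p + q) r = det2 p r + det2 q r"
  and det2_add_right: "det2 r (p + q) = det2 r p + det2 r q"
  and det2_diff_left: "det2 (p - q) r = det2 p r - det2 q r"
  and det2_diff_right: "det2 r (p - q) = det2 r p - det2 r q"
  and det2_minus_left: "det2 (- p) r = - det2 p r"
  and det2_minus_right: "det2 r (- p) = - det2 r p"
  and det2_self: "det2 p p = 0"
  by (simp_all add: det2_def algebra_simps)

lemmas det2_linear = det2_add_left det2_add_right det2_diff_left det2_diff_right
  det2_minus_left det2_minus_right det2_self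

lemma det2_swap: "det2 p q = - det2 q p"
  by (simp add: det2_def)

text \<open>Both products in the determinant contain one coordinate of \<open>u\<close> and one of
  \<open>v\<close>. Applied to two edges of a triangle, this makes the product of their lattice
  lengths divide twice the area.\<close>

lemma lattice_length_mult_dvd_det2: "lattice_length u * lattice_length v dvd det2 u v"
proof -
  have "lattice_length u * lattice_length v dvd fst u * snd v"
    "lattice_length u * lattice_length v dvd snd u * fst v"
    unfolding lattice_length_def by (simp_all add: mult_dvd_mono)
  then show ?thesis
    unfolding det2_def by (rule dvd_diff)
qed

text \<open>Dividing \<open>u\<close> by the gcd of its coordinates gives the primitive vector
  \<open>e\<close>; the Bezout coefficients of that gcd supply the \<open>f\<close> that completes
  it to a basis.\<close>

lemma primitive_basis:
  assumes "u \<noteq> 0"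
  obtains e f where "u = (lattice_length u * fst e, lattice_length u * snd e)" "det2 e f = 1"
proof -
  define n where "n = lattice_length u"
  have n: "n \<noteq> 0" using assms by (simp add: n_def lattice_length_def prod_eq_iff)
  obtain a b where ab: "fst u = n * a" "snd u = n * b"
    unfolding n_def lattice_length_def by (metis dvd_def gcd_dvd1 gcd_dvd2)
  obtain r s where "r * fst u + s * snd u = n"
    unfolding n_def lattice_length_def using bezout_int by blast
  then have "n * (r * a + s * b) = n * 1" using ab by (simp add: algebra_simps)
  then have "r * a + s * b = 1" using n by (metis mult_left_cancel)
  then show ?thesis
    using ab by (intro that[of "(a, b)" "(- s, r)"]) (auto simp: det2_def n_def algebra_simps prod_eq_iff)
qed

text \<open>Cramer's rule with determinant 1, so the coordinates are integers.\<close>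

lemma unimodular_coordinates:
  assumes "det2 e f = 1"
  shows "p = (det2 p f * fst e + det2 e p * fst f, det2 p f * snd e + det2 e p * snd f)"
proof -
  have "fst p = fst p * det2 e f" "snd p = snd p * det2 e f" using assms by simp_all
  then show ?thesis by (auto simp: det2_def prod_eq_iff algebra_simps)
qed

section \<open>Lattice points of a half-open parallelogram\<close>

text \<open>Used to count one row of the parallelogram: the offset \<open>k\<close>, which comes
  from the shear, moves the window but does not affect the number of points in it.\<close>

lemma card_multiples_in_window:
  fixes h k n :: int
  assumes "h > 0"
  shows "finite {s. 0 \<le> s * h - k \<and> s * h - k < n * h}"
    and "card {s. 0 \<le> s * h - k \<and> s * h - k < n * h} = nat n"
proof -
  \<comment> \<open>This is the ceiling of \<open>k / h\<close>, the least \<open>s\<close> with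
    \<open>k \<le> s * h\<close>. The upper end of the window is the same condition for
    \<open>s - n\<close>.\<close>
  define c where "c = - ((- k) div h)"
  have c: "k \<le> s * h \<longleftrightarrow> c \<le> s" for s
  proof -
    have "k \<le> s * h \<longleftrightarrow> - s * h \<le> - k" by simp
    also have "\<dots> \<longleftrightarrow> - s \<le> (- k) div h"
    proof
      assume "- s * h \<le> - k"
      then have "(- s * h) div h \<le> (- k) div h" using assms by (rule zdiv_mono1)
      also have "(- s * h) div h = - s" using assms by (intro nonzero_mult_div_cancel_right) simp
      finally show "- s \<le> (- k) div h" .
    next
      assume "- s \<le> (- k) div h"
      then have "- s * h \<le> (- k) div h * h" using assms by (intro mult_right_mono) auto
      also have "\<dots> \<le> - k" using pos_mod_sign[OF assms, of "- k"] div_mult_mod_eq[of "- k" h] by linarith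
      finally show "- s * h \<le> - k" .
    qed
    finally show ?thesis unfolding c_def by linarith
  qed
  have "{s. 0 \<le> s * h - k \<and> s * h - k < n * h} = {c..<c + n}"
  proof (intro set_eqI)
    fix s
    have "s * h - k < n * h \<longleftrightarrow> \<not> k \<le> (s - n) * h" by (auto simp: algebra_simps)
    then show "s \<in> {s. 0 \<le> s * h - k \<and> s * h - k < n * h} \<longleftrightarrow> s \<in> {c..<c + n}"
      using c[of s] c[of "s - n"] by auto
  qed
  then show "finite {s. 0 \<le> s * h - k \<and> s * h - k < n * h}"
    and "card {s. 0 \<le> s * h - k \<and> s * h - k < n * h} = nat n"
    by simp_all
qed

context
  fixes u v :: "int \<times> int"
  assumes D_pos: "det2 u v > 0"
begin

lemma nonzero: "u \<noteq> 0"
  using D_pos by (auto simp: det2_def)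

lemma card_half_open_parallelogram:
  "finite {p. 0 \<le> det2 p v \<and> det2 p v < det2 u v \<and> 0 \<le> det2 u p \<and> det2 u p < det2 u v}" (is "finite ?Q")
  "card {p. 0 \<le> det2 p v \<and> det2 p v < det2 u v \<and> 0 \<le> det2 u p \<and> det2 u p < det2 u v} = nat (det2 u v)"
  and card_half_open_edge:
  "finite {p. det2 u p = 0 \<and> 0 \<le> det2 p v \<and> det2 p v < det2 u v}" (is "finite ?E")
  "card {p. det2 u p = 0 \<and> 0 \<le> det2 p v \<and> det2 p v < det2 u v} = nat (lattice_length u)"
proof -
  \<comment> \<open>In unimodular coordinates with first axis along \<open>u\<close>, the parallelogram consists of
    \<open>h\<close> rows of \<open>n = lattice_length u\<close> points each.\<close>
  obtain e f where ef: "u = (lattice_length u * fst e, lattice_length u * snd e)" "det2 e f = 1"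
    using primitive_basis nonzero by blast
  define n where "n = lattice_length u"
  \<comment> \<open>The row index \<open>t\<close> comes first, so that the parallelogram becomes a
    \<open>Sigma\<close> over its rows.\<close>
  define g where "g = (\<lambda>(t, s). (s * fst e + t * fst f, s * snd e + t * snd f))"
  define g' where "g' = (\<lambda>p. (det2 e p, det2 p f))"
  have u: "u = (n * fst e, n * snd e)" using ef n_def by simp
  have gg': "g (g' p) = p" for p
    using unimodular_coordinates[OF ef(2), of p] by (simp add: g_def g'_def)
  have g'g: "g' (g w) = w" for w
  proof -
    have "g' (g w) = (fst w * det2 e f, snd w * det2 e f)"
      by (cases w) (simp add: g_def g'_def det2_def algebra_simps)
    then show ?thesis using ef by simp
  qed
  define h where "h = det2 e v"
  define q where "q = - det2 f v"
  have D: "det2 u v = n * h" by (subst u) (simp add: h_def det2_def algebra_simps)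
  have n0: "n \<ge> 0" by (simp add: n_def lattice_length_def)
  have n: "n > 0" and h: "h > 0" using D_pos n0 unfolding D
    by (auto simp: zero_less_mult_iff)
  have up: "det2 u (g w) = n * fst w" for w
  proof -
    have "det2 u (g w) = n * (fst w * det2 e f)"
      by (subst u, cases w) (simp add: g_def det2_def algebra_simps)
    then show ?thesis using ef by simp
  qed
  have pv: "det2 (g w) v = snd w * h - fst w * q" for w
    by (cases w) (simp add: g_def h_def q_def det2_def algebra_simps)
  \<comment> \<open>The points \<open>s\<close> of row \<open>t\<close>; the shear displaces the
    window by \<open>t * q\<close>.\<close>
  define R where "R = (\<lambda>t. {s. 0 \<le> s * h - t * q \<and> s * h - t * q < n * h})"
  have R: "finite (R t)" "card (R t) = nat n" for t
    unfolding R_def using card_multiples_in_window[OF h] by simp_all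
  have transfer: "g ` {w. P (g w)} = {p. P p}" for P
  proof (intro set_eqI iffI)
    fix p assume "p \<in> {p. P p}"
    then show "p \<in> g ` {w. P (g w)}" using gg' by (intro image_eqI[of _ _ "g' p"]) auto
  qed auto
  have inj: "inj g" using g'g by (metis injI)
  have card: "card {p. P p} = card {w. P (g w)}" "finite {w. P (g w)} \<Longrightarrow> finite {p. P p}" for P
    using card_image[OF inj_on_subset[OF inj subset_UNIV], of "{w. P (g w)}"] transfer[of P]
      finite_imageI[of "{w. P (g w)}" g]
    by simp_all
  have Q: "{w. 0 \<le> det2 (g w) v \<and> det2 (g w) v < det2 u v \<and> 0 \<le> det2 u (g w) \<and> det2 u (g w) < det2 u v}
      = Sigma {0..<h} R"
    unfolding up pv D R_def using n by (auto simp: zero_le_mult_iff)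
  have E: "{w. det2 u (g w) = 0 \<and> 0 \<le> det2 (g w) v \<and> det2 (g w) v < det2 u v} = {0} \<times> R 0"
    unfolding up pv D R_def using n by auto
  show "finite ?Q" by (rule card(2)) (simp only: Q, simp add: R)
  show "finite ?E" by (rule card(2)) (simp only: E, simp add: R)
  have "card ?Q = card (Sigma {0..<h} R)"
    by (subst card(1)) (simp only: Q)
  also have "\<dots> = nat (det2 u v)"
    using R h n D by (simp add: card_SigmaI nat_mult_distrib)
  finally show "card ?Q = nat (det2 u v)" .
  have "card ?E = card ({0::int} \<times> R 0)"
    by (subst card(1)) (simp only: E)
  then show "card ?E = nat (lattice_length u)"
    using R by (simp add: card_cartesian_product n_def)
qed
end

section \<open>The arithmetic contradiction\<close>

lemma no_sector_arith:
  fixes x y z A c :: int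
  assumes "c \<ge> 2" "x > 0" "y > 0" "z > 0" "A > 0"
    and "x * y dvd A" "x * z dvd A" "y * z dvd A"
    and lo: "c * (x + y + z - 2) < A" and hi: "A < (c + 1) * (x + y + z - 2 * (c + 1))"
  shows False
proof -
  \<comment> \<open>The case in which \<open>x\<close> is the longest edge; the others follow by
    symmetry.\<close>
  have *: False
    if xyz: "y \<le> x" "z \<le> x" "x > 0" "y > 0" "z > 0" and dvd: "x * y dvd A" "x * z dvd A"
      and lo: "c * (x + y + z - 2) < A" and hi: "A < (c + 1) * (x + y + z - 2 * (c + 1))"
    for x y z
  proof -
    obtain k l where k: "A = x * y * k" and l: "A = x * z * l"
      using dvd unfolding dvd_def by blast
    define h where "h = y * k"
    have A: "A = x * h" by (simp add: h_def k)
    have "x * h = x * (z * l)" using A l by (metis mult.assoc)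
    then have h': "h = z * l" using xyz by simp
    have "h > 0" using A \<open>A > 0\<close> xyz by (simp add: zero_less_mult_iff)
    then have "k > 0" "l > 0"
      using zero_less_mult_pos[of y k] zero_less_mult_pos[of z l] h' h_def xyz by simp_all
    then have hy: "y \<le> h" "z \<le> h"
      using mult_left_mono[of 1 k y] mult_left_mono[of 1 l z] xyz by (simp add: h_def, simp add: h')
    \<comment> \<open>Otherwise \<open>A = x * h \<le> c * x\<close>, which is at most
      \<open>c * (x + y + z - 2)\<close> because \<open>y + z \<ge> 2\<close>.\<close>
    have "c < h"
    proof (rule ccontr)
      assume "\<not> c < h"
      then have "x * h \<le> x * c" using xyz by simp
      moreover have "c * x \<le> c * (x + y + z - 2)" using xyz assms(1) by (intro mult_left_mono) auto
      ultimately show False using lo A by (simp add: mult.commute)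
    qed
    define m where "m = c + 1"
    have m: "m \<ge> 3" "c = m - 1" "m \<le> h" using assms(1) \<open>c < h\<close> by (auto simp: m_def)
    \<comment> \<open>Replacing \<open>y\<close> and \<open>z\<close> by \<open>h\<close> in the
      upper bound leaves \<open>h - m\<close> as a common factor. It may be cancelled: for
      \<open>h = m\<close> the strict inequality would read \<open>0 < 0\<close>.\<close>
    have "m * (y + z - 2 * m) \<le> m * (2 * (h - m))" using hy m by (intro mult_left_mono) auto
    then have "x * (h - m) < 2 * m * (h - m)"
      using hi A m by (simp add: algebra_simps)
    then have "x < 2 * m" using m by (simp add: mult_less_cancel_right)
    then have b: "x + y + z \<le> 6 * m - 3" using xyz by linarith
    \<comment> \<open>The integer \<open>A\<close> lies strictly between the two bounds, so they
      differ by at least 2.\<close>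
    have "(m - 1) * (x + y + z - 2) + 2 \<le> m * (x + y + z - 2 * m)" using lo hi m by simp
    then have "2 * (m * m) - 2 * m + 4 \<le> x + y + z" by (simp add: algebra_simps)
    then have quad: "2 * (m * m) + 7 \<le> 8 * m" using b by linarith
    show False
    \<comment> \<open>For \<open>m = 3\<close> the inequality \<open>quad\<close> reads 25 \<le> 24,
      so the 2 gained above matters. From \<open>m = 4\<close> on, the quadratic term alone reaches
      \<open>8 * m\<close>.\<close>
    proof (cases "m = 3")
      case True
      then show False using quad by simp
    next
      case False
      then have "4 * m \<le> m * m" using m by (intro mult_right_mono) auto
      then show False using quad by linarith
    qed
  qed
  consider "y \<le> x" "z \<le> x" | "x \<le> y" "z \<le> y" | "x \<le> z" "y \<le> z" by linarith
  then show False
  proof cases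
    case 1 then show False using *[of y x z] assms by simp
  next
    case 2 then show False using *[of x y z] assms by (simp add: ac_simps)
  next
    case 3 then show False using *[of x z y] assms by (simp add: ac_simps)
  qed
qed

section \<open>Boundary points and Pick's formula for a triangle with a vertex at the origin\<close>

context
  fixes u v :: "int \<times> int"
  assumes D_pos: "det2 u v > 0"
begin

lemma lattice_length_pos: "lattice_length u > 0" "lattice_length v > 0" "lattice_length (v - u) > 0"
proof -
  have "u \<noteq> 0" "v \<noteq> 0" "v - u \<noteq> 0" using D_pos by (auto simp: det2_def)
  then show "lattice_length u > 0" "lattice_length v > 0" "lattice_length (v - u) > 0"
    by (auto simp: lattice_length_def prod_eq_iff)
qed

lemma card_triangle_boundary:
  "card {p. 0 \<le> det2 p v \<and> 0 \<le> det2 u p \<and> det2 p v + det2 u p \<le> det2 u v \<and>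
      (det2 p v = 0 \<or> det2 u p = 0 \<or> det2 p v + det2 u p = det2 u v)}
    = nat (lattice_length u + lattice_length v + lattice_length (v - u))" (is "card ?B = _")
  and pick_triangle:
  "2 * int (card {p. 0 < det2 p v \<and> 0 < det2 u p \<and> det2 p v + det2 u p < det2 u v})
    + lattice_length u + lattice_length v + lattice_length (v - u) = det2 u v + 2"
proof -
  define D where "D = det2 u v"
  \<comment> \<open>The edges are half-open cyclically: each contains exactly one of its end points.\<close>
  define E1 where "E1 = {p. det2 u p = 0 \<and> 0 \<le> det2 p v \<and> det2 p v < D}"
  define E2 where "E2 = {p. det2 p v = 0 \<and> 0 < det2 u p \<and> det2 u p \<le> D}"
  define E3 where "E3 = {p. det2 p v + det2 u p = D \<and> 0 < det2 p v \<and> det2 p v \<le> D}"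
  have E1: "finite E1" "card E1 = nat (lattice_length u)"
    using card_half_open_edge[OF D_pos] unfolding E1_def D_def by simp_all
  \<comment> \<open>The pair \<open>v\<close>, \<open>- u\<close> has the same determinant as
    \<open>u\<close>, \<open>v\<close>, so the edge count applies to the segment from 0 to
    \<open>v\<close> without \<open>v\<close>. The map \<open>p\<close> to \<open>v - p\<close>
    reverses it, so that \<open>v\<close> is included instead of 0.\<close>
  have "(\<lambda>p. v - p) ` {p. det2 v p = 0 \<and> 0 \<le> det2 p (- u) \<and> det2 p (- u) < D} = E2"
    (is "?f ` ?E = _")
  proof (intro set_eqI iffI)
    fix p assume "p \<in> E2"
    then show "p \<in> ?f ` ?E"
      by (intro image_eqI[of _ _ "v - p"])
        (auto simp: E2_def D_def det2_linear det2_swap[of v] det2_swap[of p u])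
  qed (auto simp: E2_def D_def det2_linear det2_swap[of v] det2_swap[of _ u])
  moreover have "det2 v (- u) = D" using det2_swap[of v u] by (simp add: D_def det2_linear)
  moreover have "inj ?f" by (simp add: inj_def)
  ultimately have E2: "finite E2" "card E2 = nat (lattice_length v)"
    using card_half_open_edge[of v "- u"] D_pos card_image[of ?f ?E] D_def
      finite_imageI[of ?E ?f] by (auto simp: inj_on_def)
  \<comment> \<open>Likewise for the pair \<open>v - u\<close>, \<open>- v\<close>, again of
    determinant \<open>D\<close>; translation by \<open>u\<close> gives the edge from
    \<open>u\<close> to \<open>v\<close> with \<open>u\<close> included.\<close>
  have "(\<lambda>p. u + p) ` {p. det2 (v - u) p = 0 \<and> 0 \<le> det2 p (- v) \<and> det2 p (- v) < D} = E3"
    (is "?f ` ?E = _")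
  proof (intro set_eqI iffI)
    fix p assume "p \<in> E3"
    then show "p \<in> ?f ` ?E"
      by (intro image_eqI[of _ _ "p - u"])
        (auto simp: E3_def D_def det2_linear det2_swap[of v])
  qed (auto simp: E3_def D_def det2_linear det2_swap[of v])
  moreover have "det2 (v - u) (- v) = D" by (simp add: D_def det2_linear)
  ultimately have E3: "finite E3" "card E3 = nat (lattice_length (v - u))"
    using card_half_open_edge[of "v - u" "- v"] D_pos card_image[of ?f ?E] D_def
      finite_imageI[of ?E ?f] by (auto simp: inj_on_def)
  have "?B = E1 \<union> E2 \<union> E3"
    using D_pos by (auto simp: E1_def E2_def E3_def D_def)
  moreover have "E1 \<inter> E2 = {}" "(E1 \<union> E2) \<inter> E3 = {}"
    by (auto simp: E1_def E2_def E3_def)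
  ultimately show "card ?B = nat (lattice_length u + lattice_length v + lattice_length (v - u))"
    using E1 E2 E3 lattice_length_pos by (simp add: card_Un_disjoint nat_add_distrib)

  define Q where "Q = {p. 0 \<le> det2 p v \<and> det2 p v < D \<and> 0 \<le> det2 u p \<and> det2 u p < D}"
  define I where "I = {p. 0 < det2 p v \<and> 0 < det2 u p \<and> det2 p v + det2 u p < D}"
  define J where "J = {p. det2 p v < D \<and> det2 u p < D \<and> D < det2 p v + det2 u p}"
  have Q: "finite Q" "card Q = nat D"
    using card_half_open_parallelogram[OF D_pos] unfolding Q_def D_def by simp_all
  have "(\<lambda>p. u + v - p) ` I = J"
  proof (intro set_eqI iffI)
    fix p assume "p \<in> J"
    then show "p \<in> (\<lambda>p. u + v - p) ` I"
      by (intro image_eqI[of _ _ "u + v - p"]) (auto simp: I_def J_def D_def det2_linear)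
  qed (auto simp: I_def J_def D_def det2_linear)
  moreover have "inj_on (\<lambda>p. u + v - p) I" by (auto simp: inj_on_def)
  ultimately have J: "card J = card I" using card_image by metis
  \<comment> \<open>The vertices \<open>u\<close> and \<open>v\<close> lie on the omitted sides of
    the parallelogram, whereas 0 belongs to it. Removing these two points produces the 2 in Pick's
    formula.\<close>
  have "u \<in> E3" "v \<in> E2"
    using D_pos by (auto simp: E2_def E3_def D_def det2_linear)
  then have cards: "card (E3 - {u}) = card E3 - 1" "card (E2 - {v}) = card E2 - 1"
    using E2 E3 by simp_all
  \<comment> \<open>The scaled coordinates \<open>D\<close> and 0 determine the point by Cramer's
    rule, after cancelling \<open>D\<close>.\<close>
  have u_iff: "p = u" if "p \<in> E3" "det2 p v = D" for p
  proof -
    have "det2 u p = 0" using that by (simp add: E3_def)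
    then have "D * fst p = D * fst u" "D * snd p = D * snd u"
      using that(2) unfolding D_def det2_def by algebra+
    then show ?thesis using D_pos by (simp add: D_def prod_eq_iff)
  qed
  have v_iff: "p = v" if "p \<in> E2" "det2 u p = D" for p
  proof -
    have "det2 p v = 0" using that by (simp add: E2_def)
    then have "D * fst p = D * fst v" "D * snd p = D * snd v"
      using that(2) unfolding D_def det2_def by algebra+
    then show ?thesis using D_pos by (simp add: D_def prod_eq_iff)
  qed
  have E3u: "E3 - {u} = {p. det2 p v + det2 u p = D \<and> 0 < det2 p v \<and> det2 p v < D}"
    using u_iff by (force simp: E3_def D_def)
  have E2v: "E2 - {v} = {p. det2 p v = 0 \<and> 0 < det2 u p \<and> det2 u p < D}"
    using v_iff by (force simp: E2_def D_def)
  \<comment> \<open>The parallelogram splits into the two open halves, the diagonal between them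
    without its ends, and the two sides that it contains.\<close>
  have QU: "Q = I \<union> J \<union> (E3 - {u}) \<union> (E2 - {v}) \<union> E1"
    unfolding E3u E2v using D_pos[folded D_def] by (auto simp: Q_def I_def J_def E1_def)
  then have "finite I" "finite J" using Q by simp_all
  moreover have "I \<inter> J = {}" "(I \<union> J) \<inter> (E3 - {u}) = {}" "(I \<union> J \<union> (E3 - {u})) \<inter> (E2 - {v}) = {}"
    "(I \<union> J \<union> (E3 - {u}) \<union> (E2 - {v})) \<inter> E1 = {}"
    unfolding E3u E2v by (auto simp: I_def J_def E1_def)
  ultimately have "card Q = card I + card J + (card E3 - 1) + (card E2 - 1) + card E1"
    unfolding QU using E1 E2 E3 by (simp add: card_Un_disjoint cards)
  then show "2 * int (card {p. 0 < det2 p v \<and> 0 < det2 u p \<and> det2 p v + det2 u p < det2 u v})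
    + lattice_length u + lattice_length v + lattice_length (v - u) = det2 u v + 2"
    using Q J E1 E2 E3 lattice_length_pos D_pos unfolding I_def D_def by linarith
qed
end

section \<open>Transfer to triangles in the real plane\<close>

definition lattice_vector :: "int \<times> int \<Rightarrow> real^2" where
  "lattice_vector p = vector [of_int (fst p), of_int (snd p)]"

lemma lattice_vector_nth [simp]:
  "lattice_vector p $ 1 = of_int (fst p)" "lattice_vector p $ 2 = of_int (snd p)"
  by (simp_all add: lattice_vector_def)

lemma lattice_vector_diff: "lattice_vector (p - q) = lattice_vector p - lattice_vector q"
  by (simp add: vec_eq_iff forall_2)

lemma inj_lattice_vector: "inj lattice_vector"
  by (auto simp: inj_def vec_eq_iff forall_2 prod_eq_iff)

lemma range_lattice_vector: "range lattice_vector = lattice_points"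
proof (intro set_eqI iffI)
  fix x assume "x \<in> lattice_points"
  then obtain m n where "x $ 1 = of_int m" "x $ 2 = of_int n"
    unfolding lattice_points_def Ints_def by auto (metis rangeE)
  then show "x \<in> range lattice_vector"
    by (intro image_eqI[of _ _ "(m, n)"]) (auto simp: vec_eq_iff forall_2)
qed (auto simp: lattice_points_def forall_2)

text \<open>Reduces a count in the real plane to one of integer pairs, with the vertex
  \<open>a\<close> moved to the origin.\<close>

lemma card_lattice_points_translate:
  "card (S \<inter> lattice_points) = card {p. lattice_vector (a + p) \<in> S}"
proof -
  have "(\<lambda>p. lattice_vector (a + p)) ` {p. lattice_vector (a + p) \<in> S} = S \<inter> lattice_points"
  proof (intro set_eqI iffI)
    fix x assume "x \<in> S \<inter> lattice_points"
    then obtain q where "x = lattice_vector q" "x \<in> S"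
      using range_lattice_vector by blast
    then show "x \<in> (\<lambda>p. lattice_vector (a + p)) ` {p. lattice_vector (a + p) \<in> S}"
      by (intro image_eqI[of _ _ "q - a"]) auto
  qed (use range_lattice_vector in auto)
  moreover have "inj_on (\<lambda>p. lattice_vector (a + p)) A" for A
    using inj_lattice_vector by (auto intro!: inj_onI dest!: injD)
  ultimately show ?thesis using card_image by metis
qed

text \<open>Substituting \<open>x = 1 - y - z\<close> leaves a linear system for \<open>y\<close>
  and \<open>z\<close> with columns \<open>u\<close> and \<open>v\<close>; Cramer's rule solves it,
  since the determinant is nonzero.\<close>

lemma barycentric_iff:
  fixes x y z :: real
  assumes D: "det2 u v > 0" and sum: "x + y + z = 1"
  shows "x *\<^sub>R lattice_vector a + y *\<^sub>R lattice_vector (a + u) + z *\<^sub>R lattice_vector (a + v)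
      = lattice_vector (a + p)
    \<longleftrightarrow> y * of_int (det2 u v) = of_int (det2 p v) \<and> z * of_int (det2 u v) = of_int (det2 u p)"
    (is "?l = ?r \<longleftrightarrow> _")
proof -
  define u1 u2 v1 v2 p1 p2 :: real where defs: "u1 = of_int (fst u)" "u2 = of_int (snd u)"
    "v1 = of_int (fst v)" "v2 = of_int (snd v)" "p1 = of_int (fst p)" "p2 = of_int (snd p)"
  have x: "x = 1 - y - z" using sum by simp
  have "?l = ?r \<longleftrightarrow> y * u1 + z * v1 = p1 \<and> y * u2 + z * v2 = p2"
    unfolding x vec_eq_iff forall_2 defs by (simp add: algebra_simps)
  also have "\<dots> \<longleftrightarrow> y * (u1 * v2 - u2 * v1) = p1 * v2 - p2 * v1 \<and> z * (u1 * v2 - u2 * v1) = u1 * p2 - u2 * p1"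
    (is "?A \<longleftrightarrow> ?B")
  proof
    assume ?A then show ?B by (auto simp: algebra_simps)
  next
    assume ?B
    then have "(u1 * v2 - u2 * v1) * (y * u1 + z * v1) = (u1 * v2 - u2 * v1) * p1"
      "(u1 * v2 - u2 * v1) * (y * u2 + z * v2) = (u1 * v2 - u2 * v1) * p2"
      by algebra+
    moreover have "u1 * v2 - u2 * v1 = of_int (det2 u v)" by (simp add: det2_def defs)
    ultimately show ?A using D by simp
  qed
  finally show ?thesis by (simp add: det2_def defs)
qed

context
  fixes a u v :: "int \<times> int" and T :: "(real^2) set"
  assumes D_pos: "det2 u v > 0"
    and T: "T = convex hull {lattice_vector a, lattice_vector (a + u), lattice_vector (a + v)}"
begin

text \<open>Barycentric coordinates are unique, so the existential collapses to explicit values. The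
  predicate \<open>P\<close> is left open to serve both the closed triangle
  (\<open>0 \<le> t\<close>) and its interior (\<open>0 < t\<close>).\<close>

lemma barycentric_coordinates:
  "(\<exists>x y z. P x \<and> P y \<and> P z \<and> x + y + z = 1 \<and>
      x *\<^sub>R lattice_vector a + y *\<^sub>R lattice_vector (a + u) + z *\<^sub>R lattice_vector (a + v)
        = lattice_vector (a + p))
    \<longleftrightarrow> P (1 - (of_int (det2 p v) + of_int (det2 u p)) / of_int (det2 u v))
      \<and> P (of_int (det2 p v) / of_int (det2 u v)) \<and> P (of_int (det2 u p) / of_int (det2 u v))"
  (is "?l \<longleftrightarrow> ?r")
proof
  assume ?l
  then obtain x y z where xyz: "P x" "P y" "P z" "x + y + z = 1"
    "x *\<^sub>R lattice_vector a + y *\<^sub>R lattice_vector (a + u) + z *\<^sub>R lattice_vector (a + v)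
        = lattice_vector (a + p)" by blast
  then have "y = of_int (det2 p v) / of_int (det2 u v)" "z = of_int (det2 u p) / of_int (det2 u v)"
    using barycentric_iff[OF D_pos xyz(4)] D_pos by (simp_all add: field_simps)
  moreover from this have "x = 1 - (of_int (det2 p v) + of_int (det2 u p)) / of_int (det2 u v)"
    using xyz(4) by (simp add: add_divide_distrib)
  ultimately show ?r using xyz by simp
next
  define x y z :: real where xyz: "x = 1 - (of_int (det2 p v) + of_int (det2 u p)) / of_int (det2 u v)"
    "y = of_int (det2 p v) / of_int (det2 u v)" "z = of_int (det2 u p) / of_int (det2 u v)"
  assume ?r
  then have "P x" "P y" "P z" by (simp_all add: xyz)
  moreover have sum: "x + y + z = 1" by (simp add: xyz add_divide_distrib)
  moreover have "x *\<^sub>R lattice_vector a + y *\<^sub>R lattice_vector (a + u) + z *\<^sub>R lattice_vector (a + v)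
      = lattice_vector (a + p)"
    unfolding barycentric_iff[OF D_pos sum] using D_pos by (simp add: xyz)
  ultimately show ?l by blast
qed

lemma mem_triangle_iff:
  "lattice_vector (a + p) \<in> T
    \<longleftrightarrow> 0 \<le> det2 p v \<and> 0 \<le> det2 u p \<and> det2 p v + det2 u p \<le> det2 u v"
proof -
  have "lattice_vector (a + p) \<in> T \<longleftrightarrow> (\<exists>x y z. 0 \<le> x \<and> 0 \<le> y \<and> 0 \<le> z \<and> x + y + z = 1 \<and>
      x *\<^sub>R lattice_vector a + y *\<^sub>R lattice_vector (a + u) + z *\<^sub>R lattice_vector (a + v)
        = lattice_vector (a + p))"
    unfolding T convex_hull_3 mem_Collect_eq by metis
  then show ?thesis
    using D_pos unfolding barycentric_coordinates[of "\<lambda>t. 0 \<le> t"]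
    by (simp add: zero_le_divide_iff divide_le_eq flip: of_int_add) linarith
qed

lemma mem_interior_triangle_iff:
  "lattice_vector (a + p) \<in> interior T
    \<longleftrightarrow> 0 < det2 p v \<and> 0 < det2 u p \<and> det2 p v + det2 u p < det2 u v"
proof -
  \<comment> \<open>Positive barycentric coordinates characterise the interior only for a
    nondegenerate triangle; a degenerate one has empty interior.\<close>
  have "\<not> collinear {lattice_vector a, lattice_vector (a + u), lattice_vector (a + v)}"
  proof
    assume "collinear {lattice_vector a, lattice_vector (a + u), lattice_vector (a + v)}"
    \<comment> \<open>\<open>collinear_3\<close> subtracts the middle point, so the vertex
      \<open>a\<close> is moved there.\<close>
    then have "collinear {lattice_vector (a + u), lattice_vector a, lattice_vector (a + v)}"
      by (simp add: insert_commute)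
    then have "collinear {0, lattice_vector u, lattice_vector v}"
      by (subst (asm) collinear_3) (simp_all flip: lattice_vector_diff)
    then consider "lattice_vector u = 0" | "lattice_vector v = 0"
      | r where "lattice_vector v = r *\<^sub>R lattice_vector u"
      unfolding collinear_lemma by blast
    then have "of_int (det2 u v) = (0 :: real)"
      by cases (auto simp: det2_def vec_eq_iff forall_2)
    then show False using D_pos by simp
  qed
  then have "lattice_vector (a + p) \<in> interior T \<longleftrightarrow> (\<exists>x y z. 0 < x \<and> 0 < y \<and> 0 < z \<and> x + y + z = 1 \<and>
      x *\<^sub>R lattice_vector a + y *\<^sub>R lattice_vector (a + u) + z *\<^sub>R lattice_vector (a + v)
        = lattice_vector (a + p))"
    unfolding T by (subst interior_convex_hull_3_minimal) simp_all
  then show ?thesis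
    using D_pos unfolding barycentric_coordinates[of "\<lambda>t. 0 < t"]
    by (simp add: zero_less_divide_iff divide_less_eq flip: of_int_add) linarith
qed

lemma boundary_count_triangle:
  "int (boundary_count T) = lattice_length u + lattice_length v + lattice_length (v - u)"
  and interior_count_triangle:
  "2 * int (interior_count T) + int (boundary_count T) = det2 u v + 2"
proof -
  have "closed T" unfolding T by (intro compact_imp_closed finite_imp_compact_convex_hull) simp
  then have "frontier T = T - interior T" by (simp add: frontier_def)
  then have "{p. lattice_vector (a + p) \<in> frontier T}
    = {p. 0 \<le> det2 p v \<and> 0 \<le> det2 u p \<and> det2 p v + det2 u p \<le> det2 u v \<and>
        (det2 p v = 0 \<or> det2 u p = 0 \<or> det2 p v + det2 u p = det2 u v)}"
    by (auto simp: mem_triangle_iff mem_interior_triangle_iff)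
  then have "boundary_count T = nat (lattice_length u + lattice_length v + lattice_length (v - u))"
    unfolding boundary_count_def card_lattice_points_translate[of _ a]
    by (simp only: card_triangle_boundary[OF D_pos])
  then show *: "int (boundary_count T) = lattice_length u + lattice_length v + lattice_length (v - u)"
    using lattice_length_pos[OF D_pos] by simp
  show "2 * int (interior_count T) + int (boundary_count T) = det2 u v + 2"
    unfolding * interior_count_def card_lattice_points_translate[of _ a] mem_interior_triangle_iff
    using pick_triangle[OF D_pos] by simp
qed

end

section \<open>From lattice triangles to edge vectors, and the conclusion\<close>

text \<open>A polytope is the hull of its extreme points, and these belong to any generating set,
  hence are lattice points here. Dimension 2 rules out determinant zero, and exchanging two vertices
  makes it positive.\<close>

lemma lattice_triangle_vertices:
  assumes "lattice_triangle T"
  obtains a u v where "det2 u v > 0"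
    "T = convex hull {lattice_vector a, lattice_vector (a + u), lattice_vector (a + v)}"
proof -
  define E where "E = {x. x extreme_point_of T}"
  obtain V where V: "finite V" "V \<subseteq> lattice_points" "T = convex hull V" "aff_dim T = 2" "card E = 3"
    using assms unfolding lattice_triangle_def lattice_polygon_def E_def by blast
  have T: "T = convex hull E" using V Krein_Milman_polytope E_def by metis
  have "E \<subseteq> range lattice_vector"
    using V(2) extreme_points_of_convex_hull[of V] unfolding E_def V(3) range_lattice_vector by blast
  moreover obtain x y z where "E = {x, y, z}"
    using V(5) by (auto simp: card_Suc_eq numeral_3_eq_3)
  ultimately obtain a b c where E: "E = {lattice_vector a, lattice_vector b, lattice_vector c}"
    by auto
  have "det2 (b - a) (c - a) \<noteq> 0"
  proof
    define u v where "u = b - a" and "v = c - a"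
    assume "det2 (b - a) (c - a) = 0"
    then have "real_of_int (det2 u v) = 0" by (simp add: u_def v_def)
    then have D: "real_of_int (fst u) * of_int (snd v) = of_int (snd u) * of_int (fst v)"
      by (simp add: det2_def)
    have "collinear {0, lattice_vector u, lattice_vector v}"
    proof (cases "u = 0")
      case True
      then have "lattice_vector u = 0" by (simp add: vec_eq_iff forall_2)
      then show ?thesis by simp
    next
      case False
      then consider "fst u \<noteq> 0" | "snd u \<noteq> 0" by (auto simp: prod_eq_iff)
      then have "\<exists>r. lattice_vector v = r *\<^sub>R lattice_vector u"
      proof cases
        case 1 then show ?thesis using D
          by (intro exI[of _ "of_int (fst v) / of_int (fst u)"]) (auto simp: vec_eq_iff forall_2 field_simps)
      next
        case 2 then show ?thesis using D
          by (intro exI[of _ "of_int (snd v) / of_int (snd u)"]) (auto simp: vec_eq_iff forall_2 field_simps)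
      qed
      then show ?thesis unfolding collinear_lemma by blast
    qed
    then have "collinear {lattice_vector b, lattice_vector a, lattice_vector c}"
      by (subst collinear_3) (simp_all add: u_def v_def lattice_vector_diff)
    then have "aff_dim E \<le> 1" unfolding E collinear_aff_dim by (simp add: insert_commute)
    then show False using V(4) T by (simp add: aff_dim_convex_hull)
  qed
  then consider "det2 (b - a) (c - a) > 0" | "det2 (c - a) (b - a) > 0"
    using det2_swap[of "b - a" "c - a"] by linarith
  then show ?thesis
  proof cases
    case 1 then show ?thesis using T E by (intro that[of "b - a" "c - a" a]) auto
  next
    case 2 then show ?thesis using T E by (intro that[of "c - a" "b - a" a]) (auto simp: insert_commute)
  qed
qed

lemma no_lattice_triangle_in_sector:
  fixes c :: int
  assumes c: "c \<ge> 2" and T: "lattice_triangle T"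
    and lo: "(real_of_int c - 1) / 2 * real (boundary_count T) - (real_of_int c - 1) < real (interior_count T)"
    and hi: "real (interior_count T)
      < real_of_int c / 2 * real (boundary_count T) - real_of_int c * (real_of_int c + 2)"
  shows False
proof -
  obtain a u v where D: "det2 u v > 0"
    and hull: "T = convex hull {lattice_vector a, lattice_vector (a + u), lattice_vector (a + v)}"
    using lattice_triangle_vertices[OF T] .
  define b i where "b = int (boundary_count T)" and "i = int (interior_count T)"
  have b: "b = lattice_length u + lattice_length v + lattice_length (v - u)"
    and i: "2 * i + b = det2 u v + 2"
    using boundary_count_triangle[OF D hull] interior_count_triangle[OF D hull]
    by (simp_all add: b_def i_def)
  \<comment> \<open>Doubling clears the denominators, so both inequalities can be read over the
    integers.\<close>
  have "real_of_int ((c - 1) * b - 2 * (c - 1)) < real_of_int (2 * i)"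
    using lo by (simp add: b_def i_def field_simps)
  then have lo': "(c - 1) * b - 2 * (c - 1) < 2 * i" by (simp only: of_int_less_iff)
  have "real_of_int (2 * i) < real_of_int (c * b - 2 * c * (c + 2))"
    using hi by (simp add: b_def i_def field_simps)
  then have hi': "2 * i < c * b - 2 * c * (c + 2)" by (simp only: of_int_less_iff)
  show False
  proof (rule no_sector_arith[OF c lattice_length_pos[OF D] D])
    show "lattice_length u * lattice_length v dvd det2 u v"
      by (rule lattice_length_mult_dvd_det2)
    show "lattice_length u * lattice_length (v - u) dvd det2 u v"
      using lattice_length_mult_dvd_det2[of u "v - u"] by (simp add: det2_linear)
    show "lattice_length v * lattice_length (v - u) dvd det2 u v"
      using lattice_length_mult_dvd_det2[of v "v - u"] det2_swap[of v u] by (simp add: det2_linear)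
    \<comment> \<open>Pick's formula adds \<open>b - 2\<close> to \<open>2 * i\<close>. The lower
      bound \<open>(c - 1) * (b - 2)\<close> becomes \<open>c * (b - 2)\<close>, and in the upper
      bound the constants combine to \<open>2 * (c + 1)^2\<close>.\<close>
    show "c * (lattice_length u + lattice_length v + lattice_length (v - u) - 2) < det2 u v"
      using lo' i unfolding b[symmetric] by (simp add: algebra_simps)
    show "det2 u v < (c + 1) * (lattice_length u + lattice_length v + lattice_length (v - u) - 2 * (c + 1))"
      using hi' i unfolding b[symmetric] by (simp add: algebra_simps)
  qed
qed

theorem theorem2:
  fixes c :: int
  assumes "c \<ge> 2"
  shows "(\<not> (\<exists>T. lattice_triangle T \<and>
             (real_of_int c - 1) / 2 * real (boundary_count T) - (real_of_int c - 1)
               < real (interior_count T) \<and>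
             real (interior_count T)
               < real_of_int c / 2 * real (boundary_count T)
                 - real_of_int c * (real_of_int c + 2)))
    \<and> triangle_pairs \<inter> open_sector c = {}"
  using no_lattice_triangle_in_sector[OF assms]
  unfolding triangle_pairs_def open_sector_def by auto

end
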